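(* Let $G=(V,E,W)$ be a finite connected simple weighted graph with geodesic distance $d_G$, let $\epsilon>0$ be a real number, and let $L\subseteq V$ be an $\epsilon$-net of $G$, with $d_L$ the metric induced on $L$ by $d_G$. Then the Hausdorff distance between $(V,d_G)$ and its subspace $(L,d_L)$ is at most $\epsilon$, i.e. $$d_H(V,L)=\max\Big\{\max_{u\in L}\min_{v\in V} d_G(u,v),\ \max_{v\in V}\min_{u\in L} d_G(u,v)\Big\}\le \epsilon .$$
   Context: A weighted simple graph $G=(V,E,W)$ has a finite vertex set $V$, an edge set $E$ without self-edges or multiple edges, and a positive real weight $W(u,v)$ on each edge. The geodesic distance $d_G(u,v)$ is the length of a shortest path between $u$ and $v$, the length of a path being the sum of the weights of its edges; for connected $G$ this makes $(V,d_G)$ a finite metric space. The $\epsilon$-neighbourhood of $u\in V$ is $\mathcal{N}_\epsilon(u)=\{v\in V: d_G(u,v)\le\epsilon\}$. A set $L\subseteq V$ is an $\epsilon$-sample of $G$ if $\bigcup_{u\in L}\mathcal{N}_\epsilon(u)=V$. A set $L$ is $\epsilon$-sparse if $d_G(u,u')>\epsilon$ for all distinct $u,u'\in L$. $L$ is an $\epsilon$-net of $G$ if it is both $\epsilon$-sparse and an $\epsilon$-sample of $G$. *)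

theory Defs
  imports "Graph_Theory.Graph_Theory"
begin

text \<open>
  A simple graph is encoded as a finite, symmetric, loop-free set of ordered pairs of vertices, so
  each undirected edge is a pair of opposite arcs. \<open>weight_sym\<close> says that the weight belongs to the
  undirected edge.
\<close>

locale weighted_graph = pair_graph G for G :: "'a pair_pre_digraph" +
  fixes W :: "('a \<times> 'a) weight_fun"
  assumes weight_pos: "e \<in> parcs G \<Longrightarrow> 0 < W e"
    and weight_sym: "(u, v) \<in> parcs G \<Longrightarrow> W (u, v) = W (v, u)"
begin

text \<open>
  There are finitely many vertex-simple paths between two vertices, and at least one if the graph
  is connected; the minimum is unspecified for unreachable pairs.
\<close>

definition geodesic_dist :: "'a \<Rightarrow> 'a \<Rightarrow> real" where
  "geodesic_dist u v = Min (awalk_cost W ` {p. apath u p v})"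

definition neighbourhood :: "real \<Rightarrow> 'a \<Rightarrow> 'a set" where
  "neighbourhood \<epsilon> u = {v \<in> pverts G. geodesic_dist u v \<le> \<epsilon>}"

definition is_sample :: "real \<Rightarrow> 'a set \<Rightarrow> bool" where
  "is_sample \<epsilon> L \<longleftrightarrow> L \<subseteq> pverts G \<and> (\<Union>u\<in>L. neighbourhood \<epsilon> u) = pverts G"

definition is_sparse :: "real \<Rightarrow> 'a set \<Rightarrow> bool" where
  "is_sparse \<epsilon> L \<longleftrightarrow> (\<forall>u\<in>L. \<forall>u'\<in>L. u \<noteq> u' \<longrightarrow> geodesic_dist u u' > \<epsilon>)"

definition is_net :: "real \<Rightarrow> 'a set \<Rightarrow> bool" where
  "is_net \<epsilon> L \<longleftrightarrow> is_sparse \<epsilon> L \<and> is_sample \<epsilon> L"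

end

text \<open>
  Hausdorff distance of two subsets of a common metric space with distance \<open>d\<close>. It is meaningful
  only for nonempty bounded sets, as the suprema and infima are taken in the reals.
\<close>

definition hausdorff_dist :: "('a \<Rightarrow> 'a \<Rightarrow> real) \<Rightarrow> 'a set \<Rightarrow> 'a set \<Rightarrow> real" where
  "hausdorff_dist d A B = max (SUP a\<in>A. INF b\<in>B. d a b) (SUP b\<in>B. INF a\<in>A. d a b)"

end

theory Submission
  imports Defs
begin

context weighted_graph
begin

text \<open>The two one-sided distances are bounded separately. A net point also lies in
  \<open>V\<close>, so it is at distance 0 from \<open>V\<close>, by
  \<open>geodesic_dist_self\<close>; a vertex is within \<open>\<epsilon>\<close> of some net point
  because the neighbourhoods of net points cover \<open>V\<close>. Finiteness turns suprema and
  infima into maxima and minima, and \<open>geodesic_dist_commute\<close> reconciles the order of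
  arguments.\<close>

lemma awalk_cost_rev_path:
  assumes "set p \<subseteq> parcs G"
  shows "awalk_cost W (rev_path p) = awalk_cost W p"
  using assms by (induct p) (auto dest: weight_sym)

text \<open>Reversing a path preserves its cost, so both minima range over the same set of costs.
  Unreachable pairs need no separate case: both sets are then empty and give the same unspecified
  \<open>Min\<close>.\<close>

lemma geodesic_dist_commute: "geodesic_dist u v = geodesic_dist v u"
proof -
  have "awalk_cost W ` {p. apath u p v} \<subseteq> awalk_cost W ` {p. apath v p u}" for u v
  proof
    fix c
    assume "c \<in> awalk_cost W ` {p. apath u p v}"
    then obtain p where p: "apath u p v" "c = awalk_cost W p"
      by auto
    then have "set p \<subseteq> parcs G"
      by (auto simp: apath_def)
    with p have "c = awalk_cost W (rev_path p)"
      by (simp add: awalk_cost_rev_path)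
    with p show "c \<in> awalk_cost W ` {p. apath v p u}"
      using apath_rev_path by blast
  qed
  from this[of u v] this[of v u] show ?thesis
    unfolding geodesic_dist_def by (metis subset_antisym)
qed

text \<open>A nonempty path that returns to \<open>u\<close> would repeat a vertex, so only the
  empty path remains, and it costs 0.\<close>

lemma geodesic_dist_self:
  assumes "u \<in> pverts G"
  shows "geodesic_dist u u = 0"
proof -
  have "{p. apath u p u} = {[]}"
    using assms apath_nonempty_ends by (auto simp: apath_Nil_iff)
  then show ?thesis
    by (simp add: geodesic_dist_def)
qed

end

theorem theorem1:
  fixes G :: "'a pair_pre_digraph" and W :: "'a \<times> 'a \<Rightarrow> real" and L :: "'a set" and \<epsilon> :: real
  defines "V \<equiv> pverts G" and "d \<equiv> weighted_graph.geodesic_dist G W"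
  assumes "weighted_graph G W"
    and "Digraph_Component.connected (with_proj G)"
    and "\<epsilon> > 0"
    and "L \<subseteq> V"
    and "weighted_graph.is_net G W \<epsilon> L"
  shows "hausdorff_dist d V L = max (MAX u\<in>L. MIN v\<in>V. d u v) (MAX v\<in>V. MIN u\<in>L. d u v) \<and>
    hausdorff_dist d V L \<le> \<epsilon>"
proof -
  interpret weighted_graph G W
    by fact
  have comm: "d u v = d v u" for u v
    unfolding d_def by (rule geodesic_dist_commute)
  have finV: "finite V"
    unfolding V_def by (rule pair_finite_verts)
  with \<open>L \<subseteq> V\<close> have finL: "finite L"
    by (rule finite_subset)
  \<comment> \<open>Connectedness here includes having a vertex; this excludes unspecified extrema
    over empty sets.\<close>
  have "V \<noteq> {}"
    using \<open>Digraph_Component.connected (with_proj G)\<close>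
    by (auto simp: V_def Digraph_Component.connected_def strongly_connected_def)
  have cover: "\<exists>u\<in>L. d u v \<le> \<epsilon>" if "v \<in> V" for v
    using \<open>is_net \<epsilon> L\<close> that
    unfolding is_net_def is_sample_def neighbourhood_def V_def d_def by blast
  with \<open>V \<noteq> {}\<close> have "L \<noteq> {}"
    by blast
  have "hausdorff_dist d V L = max (MAX v\<in>V. MIN u\<in>L. d v u) (MAX u\<in>L. MIN v\<in>V. d v u)"
    using finV finL \<open>V \<noteq> {}\<close> \<open>L \<noteq> {}\<close> by (simp add: hausdorff_dist_def cSup_eq_Max cInf_eq_Min)
  \<comment> \<open>\<open>hausdorff_dist\<close> puts the point of \<open>V\<close> first in
    \<open>d\<close>, the goal that of \<open>L\<close>; the two maxima are also listed in opposite
    order.\<close>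
  also have "\<dots> = max (MAX u\<in>L. MIN v\<in>V. d u v) (MAX v\<in>V. MIN u\<in>L. d u v)"
    by (subst (1 2) comm) (rule max.commute)
  finally have eq: "hausdorff_dist d V L = max (MAX u\<in>L. MIN v\<in>V. d u v) (MAX v\<in>V. MIN u\<in>L. d u v)" .
  have "(MIN v\<in>V. d u v) \<le> \<epsilon>" if "u \<in> L" for u
  proof -
    \<comment> \<open>The point \<open>u\<close> itself is the witness bounding the minimum over
      \<open>V\<close>.\<close>
    have "u \<in> V" "d u u \<le> \<epsilon>"
      using that \<open>L \<subseteq> V\<close> \<open>\<epsilon> > 0\<close> by (auto simp: d_def V_def geodesic_dist_self)
    with finV show ?thesis
      by (auto intro: Min.coboundedI[THEN order_trans])
  qed
  moreover have "(MIN u\<in>L. d u v) \<le> \<epsilon>" if "v \<in> V" for v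
    using cover[OF that] finL by (auto intro: Min.coboundedI[THEN order_trans])
  ultimately have "max (MAX u\<in>L. MIN v\<in>V. d u v) (MAX v\<in>V. MIN u\<in>L. d u v) \<le> \<epsilon>"
    using finV finL \<open>V \<noteq> {}\<close> \<open>L \<noteq> {}\<close> by simp
  with eq show ?thesis
    by simp
qed

end
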